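(* Let $L$ be a Leibniz algebra over a field $F$ (not necessarily finite-dimensional). Suppose that the ideals $N_1,N_2$ of $L$ are nilpotent of classes $c_1$ and $c_2$ respectively. Then $N_1+N_2$ is nilpotent of class at most $c_1+c_2$.
   Context: A (left) Leibniz algebra is an algebra $L$ over a field $F$ with $a(bc)=(ab)c+b(ac)$ for all $a,b,c\in L$. Ideals are two-sided. The product $AB$ of subspaces is the linear span of the products $ab$, $a\in A$, $b\in B$. The powers of a Leibniz algebra $N$ are defined by $N^1=N$ and $N^{n+1}=N N^n$. $N$ is nilpotent of class $c$ if $c\ge 0$ is the least integer with $N^{c+1}=0$ (so class $0$ means $N=0$). *)

theory Defs
  imports Complex_Main "HOL-Library.Set_Algebras"
begin

text \<open>
  A Leibniz algebra occupies a whole type \<open>'a\<close>, with scalars in the field \<open>'f\<close>; no dimension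
  assumption is made. The product is bilinear and satisfies the left Leibniz identity.
\<close>

locale leibniz_algebra = vector_space scale
  for scale :: "'f::field \<Rightarrow> 'a::ab_group_add \<Rightarrow> 'a" (infixr \<open>*s\<close> 75) +
  fixes mult :: "'a \<Rightarrow> 'a \<Rightarrow> 'a" (infixl \<open>\<cdot>\<close> 70)
  assumes linear_mult_right: "\<And>a. Vector_Spaces.linear scale scale (\<lambda>b. a \<cdot> b)"
    and linear_mult_left: "\<And>b. Vector_Spaces.linear scale scale (\<lambda>a. a \<cdot> b)"
    and leibniz_identity: "\<And>a b c. a \<cdot> (b \<cdot> c) = (a \<cdot> b) \<cdot> c + b \<cdot> (a \<cdot> c)"
begin

definition subalgebra :: "'a set \<Rightarrow> bool" where
  "subalgebra S \<longleftrightarrow> subspace S \<and> (\<forall>a\<in>S. \<forall>b\<in>S. a \<cdot> b \<in> S)"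

definition ideal :: "'a set \<Rightarrow> bool" where
  "ideal I \<longleftrightarrow> subspace I \<and> (\<forall>x. \<forall>i\<in>I. x \<cdot> i \<in> I \<and> i \<cdot> x \<in> I)"

definition set_product :: "'a set \<Rightarrow> 'a set \<Rightarrow> 'a set" where
  "set_product A B = span {a \<cdot> b | a b. a \<in> A \<and> b \<in> B}"

text \<open>
  Powers are indexed from 1; the value at exponent 0 is a dummy. The span in the ambient algebra
  of a subset of a subalgebra \<open>N\<close> is its span in \<open>N\<close>, so for a subalgebra these are the
  powers of \<open>N\<close> regarded as a Leibniz algebra in its own right.
\<close>

fun algebra_power :: "'a set \<Rightarrow> nat \<Rightarrow> 'a set" where
  "algebra_power N 0 = N"
| "algebra_power N (Suc 0) = N"
| "algebra_power N (Suc (Suc n)) = set_product N (algebra_power N (Suc n))"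

definition nilpotent_of_class :: "'a set \<Rightarrow> nat \<Rightarrow> bool" where
  "nilpotent_of_class N c \<longleftrightarrow>
     subalgebra N \<and> algebra_power N (c + 1) = {0} \<and> (\<forall>d<c. algebra_power N (d + 1) \<noteq> {0})"

end

end

theory Submission
  imports Defs
begin

text \<open>
  Left multiplication by any element is a derivation, so every power of an ideal is a left ideal.
  Read \<open>N\<^sub>i\<^sup>0\<close> as \<open>L\<close>. If \<open>u\<close> lies in the intersection of \<open>N\<^sub>1\<^sup>i\<close> and \<open>N\<^sub>2\<^sup>j\<close>, then multiplying it
  on the left by an element of \<open>N\<^sub>1\<close> raises \<open>i\<close> and preserves \<open>j\<close>, and symmetrically for \<open>N\<^sub>2\<close>.
  Hence the \<open>n\<close>-th power of \<open>N\<^sub>1 + N\<^sub>2\<close> is contained in the sum of these intersections over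
  \<open>i + j = n\<close>, all of which vanish for \<open>n = c\<^sub>1 + c\<^sub>2 + 1\<close>.
\<close>

context leibniz_algebra
begin

lemma module_hom_mult_right: "module_hom scale scale (\<lambda>b. a \<cdot> b)"
  and module_hom_mult_left: "module_hom scale scale (\<lambda>a. a \<cdot> b)"
  using linear_mult_right linear_mult_left by (simp_all add: Vector_Spaces.linear_def)

lemmas mult_add_right = module_hom.add[OF module_hom_mult_right]
  and mult_add_left = module_hom.add[OF module_hom_mult_left]
  and mult_scale_right = module_hom.scale[OF module_hom_mult_right]
  and mult_zero_right = module_hom.zero[OF module_hom_mult_right]

lemma mult_span_right:
  assumes "b \<in> span B" "subspace S" "\<And>b. b \<in> B \<Longrightarrow> a \<cdot> b \<in> S"
  shows "a \<cdot> b \<in> S"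
  using assms(1)
  by (induction rule: span_induct_alt)
     (auto simp: mult_zero_right mult_add_right mult_scale_right
       intro!: assms subspace_0 subspace_add subspace_scale)

lemma set_product_subset:
  assumes "subspace S" "\<And>a b. a \<in> A \<Longrightarrow> b \<in> B \<Longrightarrow> a \<cdot> b \<in> S"
  shows "set_product A B \<subseteq> S"
  unfolding set_product_def by (rule span_minimal) (use assms in auto)

lemma mult_in_set_product: "a \<in> A \<Longrightarrow> b \<in> B \<Longrightarrow> a \<cdot> b \<in> set_product A B"
  unfolding set_product_def by (rule span_base) auto

lemma subspace_algebra_power: "subspace N \<Longrightarrow> subspace (algebra_power N n)"
  by (induction N n rule: algebra_power.induct) (auto simp: set_product_def)

lemma ideal_subspace: "ideal N \<Longrightarrow> subspace N"
  by (simp add: ideal_def)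

lemma ideal_subalgebra: "ideal N \<Longrightarrow> subalgebra N"
  by (simp add: ideal_def subalgebra_def)

lemma ideal_sum:
  assumes "ideal M" "ideal N"
  shows "ideal (M + N)"
proof -
  have "subspace (M + N)"
    using subspace_sums[of M N] assms unfolding ideal_def set_plus_def
    by (auto elim!: back_subst[of subspace])
  moreover have "x \<cdot> i \<in> M + N \<and> i \<cdot> x \<in> M + N" if "i \<in> M + N" for x i
    using that assms
    by (auto simp: ideal_def mult_add_left mult_add_right elim!: set_plus_elim intro!: set_plus_intro)
  ultimately show ?thesis
    by (simp add: ideal_def)
qed

lemma left_ideal_algebra_power:
  assumes "ideal N" "u \<in> algebra_power N n"
  shows "x \<cdot> u \<in> algebra_power N n"
  using assms(2)
proof (induction n arbitrary: x u rule: nat_less_induct)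
  case (1 n)
  show ?case
  proof (cases "n \<le> 1")
    case True
    then have "algebra_power N n = N" by (cases n) auto
    then show ?thesis using "1.prems" assms(1) by (simp add: ideal_def)
  next
    case False
    define k where "k = n - 2"
    have n: "n = Suc (Suc k)" using False by (simp add: k_def)
    have sub: "subspace (algebra_power N n)"
      by (intro subspace_algebra_power ideal_subspace assms)
    \<comment> \<open>The Leibniz identity splits this into \<open>(xa)b + a(xb)\<close>:
      \<open>xa\<close> stays in the ideal \<open>N\<close>, and \<open>xb\<close> stays in the
      preceding power by induction.\<close>
    have "x \<cdot> (a \<cdot> b) \<in> algebra_power N n"
      if "a \<in> N" "b \<in> algebra_power N (Suc k)" for a b
    proof -
      have "x \<cdot> b \<in> algebra_power N (Suc k)" "x \<cdot> a \<in> N"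
        using "1.IH" that assms(1) n by (auto simp: ideal_def)
      then have "(x \<cdot> a) \<cdot> b \<in> algebra_power N n" "a \<cdot> (x \<cdot> b) \<in> algebra_power N n"
        using that n by (auto intro: mult_in_set_product)
      then show ?thesis
        using sub by (simp add: leibniz_identity[of x a b] subspace_add)
    qed
    moreover have "u \<in> span {a \<cdot> b | a b. a \<in> N \<and> b \<in> algebra_power N (Suc k)}"
      using "1.prems" n by (simp add: set_product_def)
    ultimately show ?thesis
      using mult_span_right[OF _ sub] by fastforce
  qed
qed

text \<open>A power beyond the first is spanned by left multiples of elements of the preceding
  power, which is a left ideal and absorbs them. From exponent 0 to 1 nothing changes, both values
  being \<open>N\<close>.\<close>

lemma algebra_power_antimono:
  assumes "ideal N" "m \<le> n"
  shows "algebra_power N n \<subseteq> algebra_power N m"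
proof -
  have "algebra_power N (Suc k) \<subseteq> algebra_power N k" for k
  proof (cases k)
    case (Suc l)
    then show ?thesis
      using set_product_subset[OF subspace_algebra_power[OF ideal_subspace[OF assms(1)]], of N _ k]
        left_ideal_algebra_power[OF assms(1)] by auto
  qed simp
  then show ?thesis
    using assms(2) by (rule lift_Suc_antimono_le)
qed

text \<open>Turns the vanishing of one power into a bound on the class, by taking the least exponent
  that works.\<close>

lemma nilpotent_of_class_exists:
  assumes "subalgebra N" "algebra_power N (n + 1) = {0}"
  shows "\<exists>c\<le>n. nilpotent_of_class N c"
proof -
  let ?c = "LEAST c. algebra_power N (c + 1) = {0}"
  have "?c \<le> n" "algebra_power N (?c + 1) = {0}"
    using assms(2) by (rule Least_le, rule LeastI)
  then show ?thesis
    unfolding nilpotent_of_class_def using assms(1) not_less_Least by blast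
qed

text \<open>Exponent 0 must impose no condition, since a product may have no factor from one of the
  two ideals; the dummy value \<open>algebra_power N 0 = N\<close> would be too small.\<close>

definition power_or_univ :: "'a set \<Rightarrow> nat \<Rightarrow> 'a set" where
  "power_or_univ N n = (if n = 0 then UNIV else algebra_power N n)"

lemma power_or_univ_left_ideal:
  "ideal N \<Longrightarrow> u \<in> power_or_univ N n \<Longrightarrow> x \<cdot> u \<in> power_or_univ N n"
  by (auto simp: power_or_univ_def left_ideal_algebra_power)

text \<open>For \<open>n = 0\<close> the factor \<open>u\<close> is arbitrary, and \<open>N\<close>
  absorbs it as a right ideal; for larger \<open>n\<close> this is the recursion of the
  powers.\<close>

lemma power_or_univ_Suc:
  "ideal N \<Longrightarrow> a \<in> N \<Longrightarrow> u \<in> power_or_univ N n \<Longrightarrow> a \<cdot> u \<in> power_or_univ N (Suc n)"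
  by (cases n) (auto simp: power_or_univ_def ideal_def mult_in_set_product)

lemma power_or_univ_eq_0:
  assumes "ideal N" "algebra_power N (c + 1) = {0}" "c < n" "u \<in> power_or_univ N n"
  shows "u = 0"
  using algebra_power_antimono[OF assms(1), of "c + 1" n] assms(2-) by (auto simp: power_or_univ_def)

lemma algebra_power_sum_subset:
  assumes M: "ideal M" and N: "ideal N"
  shows "algebra_power (M + N) (Suc n)
    \<subseteq> span (\<Union>i\<le>Suc n. power_or_univ M i \<inter> power_or_univ N (Suc n - i))"
proof (induction n)
  case 0
  let ?U = "\<Union>i\<le>Suc 0. power_or_univ M i \<inter> power_or_univ N (Suc 0 - i)"
  \<comment> \<open>The index \<open>i = 1\<close> contributes \<open>M\<close>, the index
    \<open>i = 0\<close> contributes \<open>N\<close>.\<close>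
  have MU: "M \<subseteq> ?U" and NU: "N \<subseteq> ?U"
    by (auto simp: power_or_univ_def)
  show ?case
  proof
    fix x
    assume "x \<in> algebra_power (M + N) (Suc 0)"
    then have "x \<in> M + N"
      by simp
    then obtain a b where x: "x = a + b" and "a \<in> M" and "b \<in> N"
      by (rule set_plus_elim)
    have "a \<in> span ?U"
      using MU \<open>a \<in> M\<close> by (intro span_base) (rule subsetD)
    moreover have "b \<in> span ?U"
      using NU \<open>b \<in> N\<close> by (intro span_base) (rule subsetD)
    ultimately show "x \<in> span ?U"
      unfolding x by (rule span_add)
  qed
next
  case (Suc n)
  let ?U = "\<lambda>n. \<Union>i\<le>n. power_or_univ M i \<inter> power_or_univ N (n - i)"
  have step: "a \<cdot> u \<in> span (?U (Suc (Suc n)))" if a: "a \<in> M + N" and u: "u \<in> ?U (Suc n)" for a u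
  proof -
    obtain x y where a_eq: "a = x + y" and x: "x \<in> M" and y: "y \<in> N"
      using a by (rule set_plus_elim)
    obtain i where i: "i \<le> Suc n" and uM: "u \<in> power_or_univ M i"
      and uN: "u \<in> power_or_univ N (Suc n - i)"
      using u by blast
    \<comment> \<open>A factor from \<open>M\<close> raises the first exponent and keeps the second,
      because \<open>Suc (Suc n) - Suc i\<close> equals \<open>Suc n - i\<close>.\<close>
    have "x \<cdot> u \<in> power_or_univ M (Suc i) \<inter> power_or_univ N (Suc (Suc n) - Suc i)"
      using power_or_univ_Suc[OF M x uM] power_or_univ_left_ideal[OF N uN] by simp
    then have "x \<cdot> u \<in> ?U (Suc (Suc n))"
      using i by (intro UN_I[of "Suc i"]) simp_all
    \<comment> \<open>Here \<open>i\<close> stays and the second exponent grows;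
      \<open>i \<le> Suc n\<close> keeps the truncated subtraction exact.\<close>
    moreover have "y \<cdot> u \<in> power_or_univ M i \<inter> power_or_univ N (Suc (Suc n) - i)"
      using power_or_univ_Suc[OF N y uN] power_or_univ_left_ideal[OF M uM] i
      by (simp add: Suc_diff_le)
    then have "y \<cdot> u \<in> ?U (Suc (Suc n))"
      using i by (intro UN_I[of i]) simp_all
    ultimately show ?thesis
      by (simp only: a_eq mult_add_left span_add span_base)
  qed
  \<comment> \<open>Left multiplication by \<open>a\<close> is linear, so the claim passes from the
    generators in \<open>?U (Suc n)\<close> to their span.\<close>
  have "a \<cdot> u \<in> span (?U (Suc (Suc n)))"
    if a: "a \<in> M + N" and u: "u \<in> algebra_power (M + N) (Suc n)" for a u
  proof (rule mult_span_right)
    show "u \<in> span (?U (Suc n))"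
      using Suc.IH u by (rule subsetD)
  qed (fact subspace_span, rule step[OF a])
  then show ?case
    unfolding algebra_power.simps by (intro set_product_subset subspace_span)
qed

lemma algebra_power_sum_eq_0:
  assumes M: "ideal M" "algebra_power M (c + 1) = {0}"
    and N: "ideal N" "algebra_power N (d + 1) = {0}"
  shows "algebra_power (M + N) (c + d + 1) = {0}"
proof -
  \<comment> \<open>Pigeonhole: two exponents with sum \<open>c + d + 1\<close> cannot satisfy both
    \<open>i \<le> c\<close> and \<open>Suc (c + d) - i \<le> d\<close>, so one of the two factors
    is zero.\<close>
  have "power_or_univ M i \<inter> power_or_univ N (Suc (c + d) - i) \<subseteq> {0}" for i
  proof (cases "c < i")
    case True
    then show ?thesis using power_or_univ_eq_0[OF M] by blast
  next
    case False
    then have "d < Suc (c + d) - i" by simp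
    then show ?thesis using power_or_univ_eq_0[OF N] by blast
  qed
  then have "span (\<Union>i\<le>Suc (c + d). power_or_univ M i \<inter> power_or_univ N (Suc (c + d) - i)) \<subseteq> {0}"
    by (intro span_minimal subspace_single_0) blast
  then have "algebra_power (M + N) (c + d + 1) \<subseteq> {0}"
    using algebra_power_sum_subset[OF M(1) N(1), of "c + d"] by simp
  moreover have "0 \<in> algebra_power (M + N) (c + d + 1)"
    by (intro subspace_0 subspace_algebra_power ideal_subspace ideal_sum M N)
  ultimately show ?thesis by blast
qed

end

theorem lemma1p5:
  fixes scale :: "'f::field \<Rightarrow> 'a::ab_group_add \<Rightarrow> 'a"
    and mult :: "'a \<Rightarrow> 'a \<Rightarrow> 'a"
    and N\<^sub>1 N\<^sub>2 :: "'a set"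
    and c\<^sub>1 c\<^sub>2 :: nat
  assumes "leibniz_algebra scale mult"
    and "leibniz_algebra.ideal scale mult N\<^sub>1"
    and "leibniz_algebra.ideal scale mult N\<^sub>2"
    and "leibniz_algebra.nilpotent_of_class scale mult N\<^sub>1 c\<^sub>1"
    and "leibniz_algebra.nilpotent_of_class scale mult N\<^sub>2 c\<^sub>2"
  shows "\<exists>c\<le>c\<^sub>1 + c\<^sub>2. leibniz_algebra.nilpotent_of_class scale mult (N\<^sub>1 + N\<^sub>2) c"
proof -
  interpret leibniz_algebra scale mult by (rule assms(1))
  show ?thesis
    using assms(2-) unfolding nilpotent_of_class_def[of N\<^sub>1] nilpotent_of_class_def[of N\<^sub>2]
    by (intro nilpotent_of_class_exists ideal_subalgebra ideal_sum algebra_power_sum_eq_0) auto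
qed

end
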